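(* Let $l,t,s,n$ be integers with $3\leq l\leq t$, $s\geq l+1$ and $n\geq 2s+1$. For integers $x$ define $$F_1(x)=(l-1)n+(t-1)\binom{x}{l}+\binom{2(s-x)+1}{2}-\left\lceil\frac{x(l-1)}{2}\right\rceil,$$ $$F_2(x)=(l-1)n+(t-1)\binom{x}{l}+ex(2(s-x)+1,K_{l,t})-\left\lceil\frac{x(l-1)}{2}\right\rceil-(2(s-x)+1)(l-1),$$ and let $r_1=\max\{F_1(x): x\in\mathbb{Z},\ \max\{2s-t+1,2l\}\leq 2x\leq 2s\}$ and $r_2=\max\{F_2(x): x\in\mathbb{Z},\ 2l\leq 2x\leq 2s-t\}$. Let $n(x)=x+(t-1)\binom{x}{l}+2(s-x)+1$ and $n_1=\max_{0\leq x\leq s}n(x)$. (i) If $n\geq n_1$, then $ex(n,\{K_{l,t},M_{s+1}\})\geq \max\{r_1,r_2\}$. (ii) If $s$ is sufficiently large (in terms of $l$ and $t$) and $n\geq 2\binom{3s}{2}$, then $$ex(n,\{K_{l,t},M_{s+1}\})\leq (l-1)n+(t-1)\binom{s}{l}-\left\lceil\frac{s(l-1)}{2}\right\rceil.$$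
   Context: All graphs are finite, simple and undirected. For a family $\mathscr{F}$ of graphs, a graph is $\mathscr{F}$-free if it contains no member of $\mathscr{F}$ as a (not necessarily induced) subgraph; $ex(n,\mathscr{F})$ is the maximum number of edges of an $\mathscr{F}$-free graph on $n$ vertices, and $ex(n,F)=ex(n,\{F\})$. $K_{l,t}$ is the complete bipartite graph with parts of sizes $l$ and $t$, and $M_{s+1}$ is the matching consisting of $s+1$ pairwise disjoint edges (so $M_{s+1}$-free means matching number at most $s$). *)

theory Defs
  imports Complex_Main
begin

definition simple_graph :: "nat \<Rightarrow> nat set set \<Rightarrow> bool" where
  "simple_graph n E \<longleftrightarrow> E \<subseteq> {e. \<exists>u v. u \<noteq> v \<and> u < n \<and> v < n \<and> e = {u, v}}"

definition contains_Klt :: "nat \<Rightarrow> nat \<Rightarrow> nat set set \<Rightarrow> bool" where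
  "contains_Klt l t E \<longleftrightarrow>
     (\<exists>A B. A \<inter> B = {} \<and> card A = l \<and> card B = t \<and> (\<forall>a\<in>A. \<forall>b\<in>B. {a, b} \<in> E))"

definition contains_matching :: "nat \<Rightarrow> nat set set \<Rightarrow> bool" where
  "contains_matching k E \<longleftrightarrow>
     (\<exists>M. M \<subseteq> E \<and> card M = k \<and> (\<forall>e\<in>M. \<forall>f\<in>M. e \<noteq> f \<longrightarrow> e \<inter> f = {}))"

definition ex :: "nat \<Rightarrow> (nat set set \<Rightarrow> bool) \<Rightarrow> nat" where
  "ex n P = Max {card E | E. simple_graph n E \<and> P E}"

definition ex_Klt :: "nat \<Rightarrow> nat \<Rightarrow> nat \<Rightarrow> nat" where
  "ex_Klt n l t = ex n (\<lambda>E. \<not> contains_Klt l t E)"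

definition ex_Klt_M :: "nat \<Rightarrow> nat \<Rightarrow> nat \<Rightarrow> nat \<Rightarrow> nat" where
  "ex_Klt_M n l t s = ex n (\<lambda>E. \<not> contains_Klt l t E \<and> \<not> contains_matching (Suc s) E)"

definition ceil_half :: "int \<Rightarrow> int" where
  "ceil_half y = \<lceil>real_of_int y / 2\<rceil>"

definition F1 :: "nat \<Rightarrow> nat \<Rightarrow> nat \<Rightarrow> nat \<Rightarrow> int \<Rightarrow> int" where
  "F1 l t s n x = (int l - 1) * int n + (int t - 1) * int (nat x choose l)
     + int (nat (2 * (int s - x) + 1) choose 2) - ceil_half (x * (int l - 1))"

definition F2 :: "nat \<Rightarrow> nat \<Rightarrow> nat \<Rightarrow> nat \<Rightarrow> int \<Rightarrow> int" where
  "F2 l t s n x = (int l - 1) * int n + (int t - 1) * int (nat x choose l)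
     + int (ex_Klt (nat (2 * (int s - x) + 1)) l t) - ceil_half (x * (int l - 1))
     - (2 * (int s - x) + 1) * (int l - 1)"

definition r1 :: "nat \<Rightarrow> nat \<Rightarrow> nat \<Rightarrow> nat \<Rightarrow> int" where
  "r1 l t s n = Max (F1 l t s n ` {x. max (2 * int s - int t + 1) (2 * int l) \<le> 2 * x \<and> 2 * x \<le> 2 * int s})"

definition R2dom :: "nat \<Rightarrow> nat \<Rightarrow> nat \<Rightarrow> int set" where
  "R2dom l t s = {x. 2 * int l \<le> 2 * x \<and> 2 * x \<le> 2 * int s - int t}"

text \<open>r2 is only meaningful when R2dom is nonempty (otherwise the max is over the empty set).\<close>
definition r2 :: "nat \<Rightarrow> nat \<Rightarrow> nat \<Rightarrow> nat \<Rightarrow> int" where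
  "r2 l t s n = Max (F2 l t s n ` R2dom l t s)"

definition nfun :: "nat \<Rightarrow> nat \<Rightarrow> nat \<Rightarrow> nat \<Rightarrow> nat" where
  "nfun l t s x = x + (t - 1) * (x choose l) + 2 * (s - x) + 1"

definition n1 :: "nat \<Rightarrow> nat \<Rightarrow> nat \<Rightarrow> nat" where
  "n1 l t s = Max (nfun l t s ` {0..s})"

end

theory Submission
  imports Defs
begin

text \<open>
  Upper bound: let \<open>X\<close> be the set of vertices of degree greater than \<open>2s\<close>. A matching
  avoiding \<open>X\<close> extends greedily through all of \<open>X\<close>, so \<open>x = |X| \<le> s\<close>, and \<open>G - X\<close> has no
  matching of size \<open>s - x + 1\<close> and maximum degree at most \<open>2s\<close>, hence at most \<open>4s(s - x)\<close> edges.
  Writing \<open>d(v)\<close> for the number of neighbours of \<open>v\<close> in \<open>X\<close>, double counting \<open>l\<close>-subsets gives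
  \<open>\<Sum>v. C(d(v), l) \<le> (t - 1) C(x, l)\<close>, and \<open>d \<le> l - 1 + C(d, l)\<close> turns this into a bound for the
  edges meeting \<open>X\<close>. For \<open>x < s\<close> the loss in \<open>C(x, l)\<close> against \<open>C(s, l)\<close> is at least
  \<open>(s - x) C(s, l) / s\<close>, which beats the linear term \<open>4s(s - x)\<close> because \<open>l \<ge> 3\<close>.

  Lower bounds: take a nearly \<open>(l - 1)\<close>-regular graph on a set \<open>X\<close> of size \<open>x\<close> and a graph \<open>H\<close> on
  \<open>2(s - x) + 1\<close> further vertices; every \<open>l\<close>-subset of \<open>X\<close> is the neighbourhood of exactly
  \<open>t - 1\<close> of the remaining vertices, and all others are joined to one fixed \<open>(l - 1)\<close>-subset of \<open>X\<close>.
  For \<open>F\<^sub>1\<close> the graph \<open>H\<close> is complete and also joined to the fixed \<open>(l - 1)\<close>-subset; for \<open>F\<^sub>2\<close> it is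
  extremal \<open>K\<^bsub>l,t\<^esub>\<close>-free and not joined to \<open>X\<close>.
\<close>

subsection \<open>The upper bound\<close>

lemma finite_simple_graphs: "finite {E. simple_graph n E}"
  by (rule finite_subset[of _ "Pow (Pow {..<n})"]) (auto simp: simple_graph_def)

lemma finite_ex_cards: "finite {card E | E. simple_graph n E \<and> P E}"
  by (rule finite_subset[of _ "card ` {E. simple_graph n E}"]) (auto simp: finite_simple_graphs)

lemma card_le_ex:
  assumes "simple_graph n E" "P E"
  shows "card E \<le> ex n P"
  unfolding ex_def by (rule Max_ge[OF finite_ex_cards]) (use assms in blast)

lemma ex_attained:
  assumes "simple_graph n E0" "P E0"
  obtains E where "simple_graph n E" "P E" "card E = ex n P"
proof -
  have "ex n P \<in> {card E | E. simple_graph n E \<and> P E}"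
    unfolding ex_def by (rule Max_in[OF finite_ex_cards]) (use assms in blast)
  then show ?thesis using that by auto
qed

definition nbh :: "'a set set \<Rightarrow> 'a \<Rightarrow> 'a set" where
  "nbh E v = {u. {v, u} \<in> E}"

lemma nbh_sym: "u \<in> nbh E v \<longleftrightarrow> v \<in> nbh E u"
  by (simp add: nbh_def insert_commute)

lemma simple_graph_edge:
  assumes "simple_graph n E" "e \<in> E"
  obtains u v where "e = {u, v}" "u < v" "v < n"
proof -
  from assms obtain u v where "u \<noteq> v" "u < n" "v < n" "e = {u, v}"
    unfolding simple_graph_def by blast
  then show ?thesis
    using that[of u v] that[of v u] by (cases "u < v") (auto simp: insert_commute)
qed

lemma simple_graph_edgeD:
  assumes "simple_graph n E" "e \<in> E"
  shows "finite e" "card e = 2" "e \<subseteq> {..<n}" "e \<noteq> {}"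
proof -
  obtain u v where "e = {u, v}" "u < v" "v < n" using simple_graph_edge[OF assms] .
  then show "finite e" "card e = 2" "e \<subseteq> {..<n}" "e \<noteq> {}" by auto
qed

lemma simple_graph_nbh:
  assumes "simple_graph n E"
  shows nbh_subset: "nbh E v \<subseteq> {..<n}" and nbh_irrefl: "v \<notin> nbh E v"
    and finite_nbh: "finite (nbh E v)" and finite_edges: "finite E"
proof -
  show "nbh E v \<subseteq> {..<n}"
    using assms unfolding nbh_def simple_graph_def by (auto simp: doubleton_eq_iff)
  then show "finite (nbh E v)" using finite_subset by blast
  show "v \<notin> nbh E v"
    using assms unfolding nbh_def simple_graph_def by (auto simp: doubleton_eq_iff)
  have "E \<subseteq> Pow {..<n}"
    using assms unfolding simple_graph_def by blast
  then show "finite E" by (rule finite_subset) simp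
qed

section \<open>Matchings and their greedy extension\<close>

lemma contains_matching_mono:
  assumes "contains_matching k E" "j \<le> k"
  shows "contains_matching j E"
proof -
  from assms obtain M where M: "M \<subseteq> E" "card M = k" "\<forall>e\<in>M. \<forall>f\<in>M. e \<noteq> f \<longrightarrow> e \<inter> f = {}"
    unfolding contains_matching_def by blast
  obtain M' where "M' \<subseteq> M" "card M' = j"
    using obtain_subset_with_card_n[of j M] M(2) assms(2) by metis
  then show ?thesis using M unfolding contains_matching_def by (intro exI[of _ M']) blast
qed

lemma card_Union_edges_le:
  assumes "simple_graph n E" "M \<subseteq> E"
  shows "card (\<Union>M) \<le> 2 * card M"
proof -
  have fM: "finite M" using assms finite_edges finite_subset by blast
  have "card e \<le> 2" if "e \<in> M" for e
    using simple_graph_edgeD(2)[OF assms(1), of e] that assms(2) by auto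
  then have "(\<Sum>e\<in>M. card e) \<le> (\<Sum>e\<in>M. 2)" by (rule sum_mono)
  then show ?thesis using card_Union_le_sum_card[of M] by simp
qed

text \<open>Greedy matching of \<open>R\<close>: while a vertex \<open>v\<close> of \<open>R\<close>
  is waiting, the matched vertices and the other waiting ones number at most
  \<open>2 * card M + card R\<close>, which is at most \<open>2 * s\<close>, so \<open>v\<close>
  still has a neighbour outside both sets.\<close>

lemma contains_matching_extend:
  assumes sg: "simple_graph n E" and "finite R"
    and "\<And>v. v \<in> R \<Longrightarrow> 2 * s < card (nbh E v)"
    and "M \<subseteq> E" "\<forall>e\<in>M. \<forall>f\<in>M. e \<noteq> f \<longrightarrow> e \<inter> f = {}"
    and "\<Union>M \<inter> R = {}" "card M + card R \<le> Suc s"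
  shows "contains_matching (card M + card R) E"
  using assms(2-)
proof (induction R arbitrary: M rule: finite_induct)
  case empty
  then show ?case unfolding contains_matching_def by auto
next
  case (insert v R)
  have fM: "finite M" using insert.prems(2) finite_edges[OF sg] finite_subset by blast
  have "card (\<Union>M \<union> R) \<le> card (\<Union>M) + card R" by (rule card_Un_le)
  also have "\<dots> \<le> 2 * card M + card R" using card_Union_edges_le[OF sg insert.prems(2)] by simp
  also have "\<dots> \<le> 2 * s"
    using insert.prems(5) insert.hyps by simp
  finally have "card (\<Union>M \<union> R) < card (nbh E v)"
    using insert.prems(1)[of v] by simp
  moreover have "finite (\<Union>M \<union> R)"
  proof -
    have "finite (\<Union>M)"
      using fM by (rule finite_Union) (use insert.prems(2) simple_graph_edgeD(1)[OF sg] in blast)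
    then show ?thesis using insert.hyps(1) by simp
  qed
  ultimately have "\<not> nbh E v \<subseteq> \<Union>M \<union> R"
    using card_mono[of "\<Union>M \<union> R" "nbh E v"] by linarith
  \<comment> \<open>The partner \<open>u\<close> must also avoid the rest of \<open>R\<close>,
    otherwise the induction hypothesis would not apply to the enlarged matching.\<close>
  then obtain u where u: "u \<in> nbh E v" "u \<notin> \<Union>M" "u \<notin> R" by blast
  have vM: "v \<notin> \<Union>M" using insert.prems(4) by blast
  have uv: "{v, u} \<in> E" "u \<noteq> v" using u(1) nbh_irrefl[OF sg] by (auto simp: nbh_def)
  have new: "{v, u} \<notin> M" using vM by blast
  have c: "card (insert {v, u} M) = Suc (card M)" using new fM by simp
  have "contains_matching (card (insert {v, u} M) + card R) E"
  proof (rule insert.IH)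
    show "\<forall>e\<in>insert {v, u} M. \<forall>f\<in>insert {v, u} M. e \<noteq> f \<longrightarrow> e \<inter> f = {}"
      using insert.prems(3) vM u(2) by blast
    show "\<Union>(insert {v, u} M) \<inter> R = {}"
      using insert.prems(4) u(3) insert.hyps by blast
  qed (use insert.prems uv insert.hyps c in auto)
  then show ?case using c insert.hyps by simp
qed

section \<open>Double counting edges and \<open>l\<close>-subsets\<close>

text \<open>An edge inside \<open>X\<close> is seen from both of its ends, an edge leaving
  \<open>X\<close> only from its outer end. Keeping weight 1 on \<open>X\<close> and weight 2
  outside is what later produces the saving of half of \<open>x * (l - 1)\<close>.\<close>

lemma card_edges_meeting_le:
  assumes sg: "simple_graph n E" and X: "X \<subseteq> {..<n}"
  shows "2 * card {e \<in> E. e \<inter> X \<noteq> {}}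
    \<le> (\<Sum>v\<in>X. card (nbh E v \<inter> X)) + 2 * (\<Sum>v\<in>{..<n} - X. card (nbh E v \<inter> X))"
proof -
  have fX: "finite X" using X finite_subset by blast
  let ?pair = "\<lambda>(v, u). {v, u}"
  define inner where "inner = {e \<in> E. e \<subseteq> X}"
  define cross where "cross = {e \<in> E. e \<inter> X \<noteq> {} \<and> \<not> e \<subseteq> X}"
  \<comment> \<open>\<open>S\<close> holds the ordered adjacent pairs inside \<open>X\<close>;
    \<open>S1\<close> and \<open>S2\<close> are its two orientations, exchanged by swapping.\<close>
  define S where "S = (SIGMA v:X. nbh E v \<inter> X)"
  define S1 where "S1 = {p \<in> S. fst p < snd p}"
  define S2 where "S2 = {p \<in> S. snd p < fst p}"
  have fS: "finite S" unfolding S_def using fX by auto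
  have swap: "S2 = prod.swap ` S1"
    unfolding S1_def S2_def S_def using nbh_sym[of _ E] by (auto simp: image_iff)
  have "card S2 = card S1" unfolding swap by (rule card_image) simp
  moreover have "S = S1 \<union> S2"
  proof -
    have "fst p \<noteq> snd p" if "p \<in> S" for p
      using that nbh_irrefl[OF sg] unfolding S_def by auto
    then show ?thesis unfolding S1_def S2_def by (auto simp: neq_iff)
  qed
  moreover have "S1 \<inter> S2 = {}" unfolding S1_def S2_def by auto
  ultimately have S: "card S = 2 * card S1"
    using fS by (metis card_Un_disjoint finite_Un mult_2)
  have "inner \<subseteq> ?pair ` S1"
  proof
    fix e assume e: "e \<in> inner"
    then obtain u v where "e = {u, v}" "u < v" "v < n"
      using simple_graph_edge[OF sg] unfolding inner_def by blast
    then show "e \<in> ?pair ` S1"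
      using e unfolding inner_def S1_def S_def nbh_def by (auto simp: image_iff intro!: bexI[of _ "(u, v)"])
  qed
  then have "card inner \<le> card S1"
    using fS surj_card_le[of S1 inner ?pair] unfolding S1_def by simp
  then have 1: "2 * card inner \<le> (\<Sum>v\<in>X. card (nbh E v \<inter> X))"
    using S fX unfolding S_def by (simp add: card_SigmaI)
  define T where "T = (SIGMA v:{..<n} - X. nbh E v \<inter> X)"
  have "cross \<subseteq> ?pair ` T"
  proof
    fix e assume e: "e \<in> cross"
    then obtain u v where uv: "e = {u, v}" "u < v" "v < n"
      using simple_graph_edge[OF sg] unfolding cross_def by blast
    then have "(u, v) \<in> T \<or> (v, u) \<in> T"
      using e unfolding cross_def T_def nbh_def by (auto simp: insert_commute)
    then show "e \<in> ?pair ` T" using uv(1) by (auto simp: image_iff insert_commute intro: bexI[of _ "(u, v)"] bexI[of _ "(v, u)"])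
  qed
  then have "card cross \<le> card T"
    using fX surj_card_le[of T cross ?pair] unfolding T_def by simp
  then have 2: "card cross \<le> (\<Sum>v\<in>{..<n} - X. card (nbh E v \<inter> X))"
    using fX unfolding T_def by (simp add: card_SigmaI)
  have "{e \<in> E. e \<inter> X \<noteq> {}} \<subseteq> inner \<union> cross" unfolding inner_def cross_def by blast
  then have "card {e \<in> E. e \<inter> X \<noteq> {}} \<le> card inner + card cross"
    using finite_edges[OF sg] card_mono[of "inner \<union> cross" "{e \<in> E. e \<inter> X \<noteq> {}}"]
      card_Un_le[of inner cross]
    unfolding inner_def cross_def by simp
  then show ?thesis using 1 2 by linarith
qed

lemma sum_choose_nbh_le:
  assumes sg: "simple_graph n E" and free: "\<not> contains_Klt l t E"
    and "1 \<le> l" "1 \<le> t" and fX: "finite X"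
  shows "(\<Sum>v<n. card (nbh E v \<inter> X) choose l) \<le> (t - 1) * (card X choose l)"
proof -
  define LL where "LL = {L. L \<subseteq> X \<and> card L = l}"
  have fLL: "finite LL" unfolding LL_def using fX by simp
  have "(\<Sum>v<n. card (nbh E v \<inter> X) choose l) = (\<Sum>v<n. \<Sum>L\<in>{L \<in> LL. L \<subseteq> nbh E v}. 1)"
  proof (rule sum.cong)
    fix v
    have "{L \<in> LL. L \<subseteq> nbh E v} = {L. L \<subseteq> nbh E v \<inter> X \<and> card L = l}"
      unfolding LL_def by blast
    then show "(card (nbh E v \<inter> X) choose l) = (\<Sum>L\<in>{L \<in> LL. L \<subseteq> nbh E v}. 1)"
      using fX n_subsets[of "nbh E v \<inter> X" l] by simp
  qed simp
  also have "\<dots> = (\<Sum>L\<in>LL. \<Sum>v\<in>{v \<in> {..<n}. L \<subseteq> nbh E v}. 1)"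
    by (rule sum.swap_restrict) (auto simp: fLL)
  also have "\<dots> \<le> (\<Sum>L\<in>LL. t - 1)"
  proof (rule sum_mono)
    fix L assume L: "L \<in> LL"
    define C where "C = {v \<in> {..<n}. L \<subseteq> nbh E v}"
    have "card C \<le> t - 1"
    proof (rule ccontr)
      assume "\<not> card C \<le> t - 1"
      then have "t \<le> card C" by simp
      then obtain B where B: "B \<subseteq> C" "card B = t"
        by (rule obtain_subset_with_card_n)
      have "\<forall>a\<in>L. \<forall>b\<in>B. {a, b} \<in> E"
      proof (intro ballI)
        fix a b assume "a \<in> L" "b \<in> B"
        then have "a \<in> nbh E b" using B(1) unfolding C_def by blast
        then show "{a, b} \<in> E" by (simp add: nbh_def insert_commute)
      qed
      moreover have "L \<inter> B = {}"
        using B(1) nbh_irrefl[OF sg] unfolding C_def by blast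
      ultimately show False
        using free L B(2) unfolding contains_Klt_def LL_def by blast
    qed
    then show "(\<Sum>v\<in>{v \<in> {..<n}. L \<subseteq> nbh E v}. 1) \<le> t - 1" unfolding C_def by simp
  qed
  also have "\<dots> = (t - 1) * (card X choose l)"
    unfolding LL_def using fX by (simp add: n_subsets)
  finally show ?thesis .
qed

section \<open>Binomial estimates\<close>

text \<open>Only \<open>d = l + k\<close> needs an argument: by Pascal's rule each further step
  raises the binomial coefficient by at least 1, so it is at least \<open>k + 1\<close>.\<close>

lemma le_pred_add_choose:
  assumes "1 \<le> l"
  shows "d \<le> (l - 1) + (d choose l)"
proof (cases "d < l")
  case False
  then obtain k where d: "d = l + k" using le_iff_add by (auto simp: not_less)
  have "Suc k \<le> (l + k) choose l"
  proof (induction k)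
    case (Suc k)
    obtain j where j: "l = Suc j" using assms by (cases l) auto
    have "0 < (l + k) choose j" using j by simp
    moreover have "(l + Suc k) choose l = ((l + k) choose j) + ((l + k) choose l)" using j by simp
    ultimately show ?case using Suc by linarith
  qed simp
  then show ?thesis using d assms by simp
qed simp

text \<open>By absorption, \<open>x choose l\<close> divided by \<open>x\<close> is a multiple of
  \<open>(x - 1) choose (l - 1)\<close>, which grows with \<open>x\<close>.\<close>

lemma mult_choose_mono:
  assumes "x \<le> s" "1 \<le> l"
  shows "s * (x choose l) \<le> x * (s choose l)"
proof (cases "x = 0")
  case False
  obtain j where l: "l = Suc j" using assms(2) by (cases l) auto
  have ab: "l * (m choose l) = m * ((m - 1) choose j)" if "m > 0" for m
    using that binomial_absorption[of j "m"] l by simp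
  have "l * (s * (x choose l)) = s * x * ((x - 1) choose j)"
    using ab[of x] False by (simp add: algebra_simps)
  also have "\<dots> \<le> s * x * ((s - 1) choose j)"
    using assms by (intro mult_left_mono binomial_right_mono) auto
  also have "\<dots> = l * (x * (s choose l))"
    using ab[of s] False assms by (simp add: algebra_simps)
  finally show ?thesis using assms(2) by simp
next
  case True
  then show ?thesis using assms by simp
qed

text \<open>Tailored to the final comparison: \<open>8 * s\<close> pays for the low-degree edges,
  \<open>l\<close> for the change from \<open>x * (l - 1)\<close> to \<open>s * (l - 1)\<close>, and
  the factor 4 is a lower bound for \<open>2 * (t - 1)\<close>. Since \<open>l - 1\<close> is at
  least 2, absorption makes \<open>s choose l\<close> at least cubic in \<open>s\<close> for fixed
  \<open>l\<close>.\<close>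

lemma choose_quadratic_lower:
  assumes "3 \<le> l" "10 * l \<le> s"
  shows "s * (8 * s + l) \<le> 4 * (s choose l)"
proof -
  obtain j where l: "l = Suc j" using assms(1) by (cases l) auto
  have s: "s > 0" using assms by simp
  have "(s - 1) choose 2 \<le> (s - 1) choose j"
    using assms l by (intro binomial_mono) auto
  moreover have "((s - 1) choose 2) * 2 = (s - 1) * (s - 2)"
    by (simp add: choose_two) (metis One_nat_def Suc_1)
  moreover have "l * (8 * s + l) \<le> 2 * ((s - 1) * (s - 2))"
  proof -
    \<comment> \<open>Writing \<open>s\<close> and \<open>l\<close> as their least values plus slack
      removes the truncated subtractions and leaves a comparison of polynomial coefficients.\<close>
    obtain r where r: "s = 10 * l + r" using assms(2) le_iff_add by blast
    obtain q where q: "l = q + 3" using assms(1) le_iff_add by (metis add.commute)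
    show ?thesis unfolding r q by (simp add: algebra_simps)
  qed
  ultimately have "l * (8 * s + l) \<le> 4 * ((s - 1) choose j)" by linarith
  then have "s * (l * (8 * s + l)) \<le> s * (4 * ((s - 1) choose j))" by simp
  also have "\<dots> = l * (4 * (s choose l))"
    using binomial_absorption[of j s] l s by simp
  finally have "l * (s * (8 * s + l)) \<le> l * (4 * (s choose l))" by (simp only: mult.left_commute)
  then show ?thesis using assms(1) by simp
qed

section \<open>The edge bound for a graph without the forbidden subgraphs\<close>

text \<open>The vertices of a maximal matching in \<open>F\<close> meet every edge of
  \<open>F\<close>; there are at most \<open>2 * k\<close> of them, each on at most \<open>D\<close>
  edges.\<close>

lemma card_edges_low_degree_le:
  assumes sg: "simple_graph n E" and FE: "F \<subseteq> E"
    and deg: "\<And>v. v \<in> \<Union>F \<Longrightarrow> card (nbh E v) \<le> D"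
    and nm: "\<not> contains_matching (Suc k) F"
  shows "card F \<le> 2 * k * D"
proof -
  define MM where "MM = {M. M \<subseteq> F \<and> (\<forall>e\<in>M. \<forall>f\<in>M. e \<noteq> f \<longrightarrow> e \<inter> f = {})}"
  have fF: "finite F" using FE finite_edges[OF sg] finite_subset by blast
  have "finite MM" unfolding MM_def using fF by simp
  moreover have "{} \<in> MM" unfolding MM_def by simp
  ultimately obtain M where M: "M \<in> MM" "\<forall>N\<in>MM. M \<subseteq> N \<longrightarrow> N = M"
    using finite_has_maximal[of MM] by (metis empty_iff)
  have MF: "M \<subseteq> F" and Mdis: "\<forall>e\<in>M. \<forall>f\<in>M. e \<noteq> f \<longrightarrow> e \<inter> f = {}"
    using M(1) unfolding MM_def by auto
  have k: "card M \<le> k"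
  proof (rule ccontr)
    assume "\<not> card M \<le> k"
    moreover have "contains_matching (card M) F"
      unfolding contains_matching_def by (rule exI[of _ M]) (use MF Mdis in simp)
    ultimately show False using nm contains_matching_mono[of "card M" F "Suc k"] by simp
  qed
  define W where "W = \<Union>M"
  have W: "card W \<le> 2 * k"
    using card_Union_edges_le[OF sg subset_trans[OF MF FE]] k unfolding W_def by simp
  have fW: "finite W"
    unfolding W_def using finite_subset[OF MF fF]
    by (rule finite_Union) (use MF FE simple_graph_edgeD(1)[OF sg] in blast)
  have "F \<subseteq> (\<Union>v\<in>W. (\<lambda>u. {v, u}) ` nbh E v)"
  proof
    fix e assume e: "e \<in> F"
    have "e \<noteq> {}" using e FE simple_graph_edgeD(4)[OF sg] by blast
    have "\<not> e \<inter> W = {}"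
    proof
      assume "e \<inter> W = {}"
      then have "insert e M \<in> MM" "e \<notin> M"
        using e MF Mdis \<open>e \<noteq> {}\<close> unfolding MM_def W_def by blast+
      then show False using M(2) by blast
    qed
    then obtain v where v: "v \<in> e" "v \<in> W" by blast
    obtain a b where ab: "e = {a, b}" using e FE simple_graph_edge[OF sg] by blast
    then obtain u where "e = {v, u}" using v(1) by blast
    then show "e \<in> (\<Union>v\<in>W. (\<lambda>u. {v, u}) ` nbh E v)"
      using v(2) e FE unfolding nbh_def by blast
  qed
  then have "card F \<le> card (\<Union>v\<in>W. (\<lambda>u. {v, u}) ` nbh E v)"
    by (rule card_mono[rotated]) (use fW finite_nbh[OF sg] in auto)
  also have "\<dots> \<le> (\<Sum>v\<in>W. card ((\<lambda>u. {v, u}) ` nbh E v))" using fW by (rule card_UN_le)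
  also have "\<dots> \<le> (\<Sum>v\<in>W. D)"
  proof (rule sum_mono)
    fix v assume "v \<in> W"
    then show "card ((\<lambda>u. {v, u}) ` nbh E v) \<le> D"
      using deg[of v] card_image_le[OF finite_nbh[OF sg], of "\<lambda>u. {v, u}" v] MF unfolding W_def by fastforce
  qed
  also have "\<dots> \<le> 2 * k * D" using W by simp
  finally show ?thesis .
qed

lemma Klt_matching_free_card_le:
  assumes l: "3 \<le> l" and t: "l \<le> t" and s: "10 * l \<le> s"
    and sg: "simple_graph n E" and free: "\<not> contains_Klt l t E"
    and nm: "\<not> contains_matching (Suc s) E"
  shows "2 * card E + s * (l - 1) \<le> 2 * (l - 1) * n + 2 * (t - 1) * (s choose l)"
proof -
  \<comment> \<open>The threshold \<open>2 * s\<close> is the degree that the greedy extension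
    requires.\<close>
  define X where "X = {v. v < n \<and> 2 * s < card (nbh E v)}"
  have Xn: "X \<subseteq> {..<n}" and fX: "finite X" unfolding X_def by auto
  define x where "x = card X"
  have xs: "x \<le> s"
  proof (rule ccontr)
    assume "\<not> x \<le> s"
    then obtain R where R: "R \<subseteq> X" "card R = Suc s"
      using obtain_subset_with_card_n[of "Suc s" X] unfolding x_def by auto
    then have "finite R" using fX finite_subset by blast
    then have "contains_matching (card ({} :: nat set set) + card R) E"
      by (rule contains_matching_extend[OF sg, of _ s]) (use R in \<open>auto simp: X_def\<close>)
    then show False using nm R by simp
  qed
  define F where "F = {e \<in> E. e \<inter> X = {}}"
  have "card F \<le> 2 * (s - x) * (2 * s)"
  proof (rule card_edges_low_degree_le[OF sg])
    show "F \<subseteq> E" unfolding F_def by blast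
    show "card (nbh E v) \<le> 2 * s" if "v \<in> \<Union>F" for v
    proof -
      from that obtain e where e: "v \<in> e" "e \<in> E" "e \<inter> X = {}" unfolding F_def by blast
      obtain a b where "e = {a, b}" "a < b" "b < n" using simple_graph_edge[OF sg e(2)] .
      then have "v < n" using e(1) by auto
      moreover have "v \<notin> X" using e by blast
      ultimately show ?thesis unfolding X_def by simp
    qed
    show "\<not> contains_matching (Suc (s - x)) F"
    proof
      assume "contains_matching (Suc (s - x)) F"
      then obtain M where M: "M \<subseteq> F" "card M = Suc (s - x)"
        "\<forall>e\<in>M. \<forall>f\<in>M. e \<noteq> f \<longrightarrow> e \<inter> f = {}"
        unfolding contains_matching_def by blast
      have "contains_matching (card M + card X) E"
        by (rule contains_matching_extend[OF sg fX, of s])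
          (use M xs in \<open>auto simp: X_def F_def x_def\<close>)
      then show False using nm M xs unfolding x_def by simp
    qed
  qed
  then have F: "2 * card F \<le> 8 * s * (s - x)" by (simp add: mult_ac)
  define d where "d v = card (nbh E v \<inter> X)" for v
  have "card E = card {e \<in> E. e \<inter> X \<noteq> {}} + card F"
    unfolding F_def using finite_edges[OF sg]
    by (subst card_Un_disjoint[symmetric]) (auto intro: arg_cong[of _ _ card])
  moreover have "2 * card {e \<in> E. e \<inter> X \<noteq> {}} \<le> (\<Sum>v\<in>X. d v) + 2 * (\<Sum>v\<in>{..<n} - X. d v)"
    using card_edges_meeting_le[OF sg Xn] unfolding d_def .
  \<comment> \<open>The factor 2 is wasteful on \<open>X\<close> but matches the weight of the outer
    vertices, so both binomial sums merge into one sum over all vertices.\<close>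
  moreover have "(\<Sum>v\<in>X. d v) \<le> (\<Sum>v\<in>X. (l - 1) + 2 * (d v choose l))"
  proof (rule sum_mono)
    fix v show "d v \<le> (l - 1) + 2 * (d v choose l)"
      using le_pred_add_choose[of l "d v"] l by simp
  qed
  moreover have "(\<Sum>v\<in>{..<n} - X. d v) \<le> (\<Sum>v\<in>{..<n} - X. (l - 1) + (d v choose l))"
    by (rule sum_mono, rule le_pred_add_choose) (use l in simp)
  moreover have "(\<Sum>v\<in>X. (l - 1) + 2 * (d v choose l)) = x * (l - 1) + 2 * (\<Sum>v\<in>X. d v choose l)"
    unfolding x_def by (simp add: sum.distrib sum_distrib_left)
  moreover have "(\<Sum>v\<in>{..<n} - X. (l - 1) + (d v choose l))
      = (n - x) * (l - 1) + (\<Sum>v\<in>{..<n} - X. d v choose l)"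
    using Xn fX unfolding x_def by (simp add: sum.distrib card_Diff_subset)
  moreover have "(\<Sum>v\<in>X. d v choose l) + (\<Sum>v\<in>{..<n} - X. d v choose l) = (\<Sum>v<n. d v choose l)"
    using sum.subset_diff[OF Xn, of "\<lambda>v. d v choose l"] by simp
  moreover have "(\<Sum>v<n. d v choose l) \<le> (t - 1) * (x choose l)"
    unfolding d_def x_def using l t by (intro sum_choose_nbh_le[OF sg free]) (auto simp: fX)
  ultimately have main: "2 * card E \<le> x * (l - 1) + 2 * ((n - x) * (l - 1))
      + 2 * ((t - 1) * (x choose l)) + 8 * s * (s - x)"
    using F by linarith
  have xn: "x \<le> n" unfolding x_def using card_mono[OF _ Xn] by simp
  define D where "D = (s choose l) - (x choose l)"
  have D: "s choose l = (x choose l) + D"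
    unfolding D_def using binomial_right_mono[OF xs, of l] by simp
  obtain j where j: "s = x + j" using xs le_iff_add by blast
  \<comment> \<open>The loss satisfies \<open>s * D \<ge> j * (s choose l)\<close>, and the
    quadratic lower bound then allows cancelling \<open>s\<close>.\<close>
  have "j * (8 * s + l) \<le> 4 * D"
  proof -
    have "j * (s choose l) \<le> s * D"
      using mult_choose_mono[OF xs, of l] l j D by (simp add: algebra_simps)
    then have "4 * (j * (s choose l)) \<le> s * (4 * D)" by simp
    moreover have "j * (s * (8 * s + l)) \<le> j * (4 * (s choose l))"
      using choose_quadratic_lower[OF l s] by (rule mult_le_mono2)
    ultimately have "s * (j * (8 * s + l)) \<le> s * (4 * D)" by (simp add: algebra_simps)
    then show ?thesis using l s by simp
  qed
  moreover have "4 * D \<le> 2 * (t - 1) * D" using l t by (intro mult_right_mono) auto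
  ultimately have "8 * s * j + j * l \<le> 2 * (t - 1) * D" by (simp add: algebra_simps)
  moreover have "j * (l - 1) \<le> j * l" by simp
  moreover have "n * (l - 1) = (n - x) * (l - 1) + x * (l - 1)"
    using xn by (simp add: diff_mult_distrib mult_le_mono1)
  moreover have "s * (l - 1) = x * (l - 1) + j * (l - 1)" by (simp only: j add_mult_distrib)
  moreover have "2 * (t - 1) * (s choose l) = 2 * ((t - 1) * (x choose l)) + 2 * (t - 1) * D"
    by (simp only: D add_mult_distrib2 mult.assoc)
  moreover have "2 * (l - 1) * n = 2 * (n * (l - 1))" by simp
  moreover have "8 * s * (s - x) = 8 * s * j" using j by simp
  ultimately show ?thesis using main by linarith
qed

subsection \<open>The constructions\<close>

text \<open>The circulant with steps \<open>1, \<dots>, d div 2\<close> modulo \<open>x\<close>; for odd \<open>d\<close> the edges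
  \<open>{i, i + x div 2}\<close> with \<open>i < x div 2\<close> are added.\<close>
lemma near_regular_graph:
  assumes "d < x"
  obtains E where "simple_graph x E" "\<And>v. card (nbh E v) \<le> d" "x * d \<le> Suc (2 * card E)"
proof -
  define K where "K = d div 2"
  define h where "h = x div 2"
  define f where "f i k = (if i + k < x then i + k else i + k - x)" for i k
  \<comment> \<open>A pair \<open>(i, k)\<close> stands for the edge leaving \<open>i\<close> by
    step \<open>k\<close>.\<close>
  define I where "I = {..<x} \<times> {1..K} \<union> (if odd d then {..<h} \<times> {h} else {})"
  define E where "E = (\<lambda>(i, k). {i, f i k}) ` I"
  have K: "2 * K < x" and Kh: "odd d \<Longrightarrow> K < h" and h: "2 * h \<le> x"
    using assms unfolding K_def h_def by presburger+
  have I: "i < x" "1 \<le> k" "2 * k \<le> x" "2 * k = x \<Longrightarrow> k = h \<and> i < h"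
    if "(i, k) \<in> I" for i k
    using that K Kh h unfolding I_def by (auto split: if_splits)
  have "inj_on (\<lambda>(i, k). {i, f i k}) I"
  proof (rule inj_onI, clarify)
    fix i k j k' assume p: "(i, k) \<in> I" "(j, k') \<in> I" "{i, f i k} = {j, f j k'}"
    note bounds = I(1-3)[OF p(1)] I(1-3)[OF p(2)]
    from p(3) consider "i = j" "f i k = f j k'" | "i = f j k'" "j = f i k"
      by (auto simp: doubleton_eq_iff)
    then show "i = j \<and> k = k'"
    proof cases
      case 1
      then show ?thesis
        using bounds unfolding f_def by (cases "i + k < x"; cases "j + k' < x") simp_all
    next
      case 2
      have "i = j + k' \<or> i + x = j + k'" using 2(1) unfolding f_def by (simp split: if_splits)
      moreover have "j = i + k \<or> j + x = i + k" using 2(2) unfolding f_def by (simp split: if_splits)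
      \<comment> \<open>An edge listed from both ends has steps adding up to \<open>x\<close>. As no
        step exceeds half of \<open>x\<close>, both are exactly half, and such edges start below
        \<open>h\<close> only.\<close>
      ultimately have "2 * k = x" "2 * k' = x" "i = j + k' \<or> j = i + k" using bounds by linarith+
      then show ?thesis using I(4)[OF p(1)] I(4)[OF p(2)] h by linarith
    qed
  qed
  then have "card E = card I" unfolding E_def by (rule card_image)
  also have "\<dots> = x * K + (if odd d then h else 0)"
  proof -
    have "odd d \<Longrightarrow> ({..<x} \<times> {1..K}) \<inter> ({..<h} \<times> {h}) = {}" using Kh by auto
    then show ?thesis unfolding I_def by (simp add: card_Un_disjoint card_cartesian_product)
  qed
  finally have cE: "card E = x * K + (if odd d then h else 0)" .
  have "x * d \<le> Suc (2 * card E)"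
  proof (cases "odd d")
    case True
    then have "d = 2 * K + 1" unfolding K_def by presburger
    moreover have "x \<le> Suc (2 * h)" unfolding h_def by presburger
    ultimately show ?thesis using cE True by (simp add: algebra_simps)
  next
    case False
    then have "d = 2 * K" unfolding K_def by presburger
    then show ?thesis using cE by (simp add: algebra_simps)
  qed
  moreover have sg: "simple_graph x E"
    unfolding simple_graph_def
  proof
    fix e assume "e \<in> E"
    then obtain i k where ik: "(i, k) \<in> I" "e = {i, f i k}" unfolding E_def by auto
    have "i \<noteq> f i k" "f i k < x" using I[OF ik(1)] unfolding f_def by auto
    then show "e \<in> {e. \<exists>u v. u \<noteq> v \<and> u < x \<and> v < x \<and> e = {u, v}}"
      using I(1)[OF ik(1)] ik(2) by blast
  qed
  moreover have "card (nbh E v) \<le> d" for v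
  proof (cases "v < x")
    case False
    then have "nbh E v = {}"
      using sg unfolding nbh_def simple_graph_def by (auto simp: doubleton_eq_iff)
    then show ?thesis by simp
  next
    case True
    \<comment> \<open>\<open>T\<close> bounds the partners of \<open>v\<close> under step
      \<open>h\<close> from above; for odd \<open>x\<close> the last vertex has none, which costs
      the \<open>Suc\<close> in the edge count when \<open>d\<close> is odd too.\<close>
    define T where "T = (if odd d then {if v < h then v + h else v - h} else {})"
    have "nbh E v \<subseteq> f v ` {1..K} \<union> (\<lambda>k. f v (x - k)) ` {1..K} \<union> T"
    proof
      fix u assume "u \<in> nbh E v"
      then obtain i k where ik: "(i, k) \<in> I" "{v, u} = {i, f i k}"
        unfolding nbh_def E_def by auto
      show "u \<in> f v ` {1..K} \<union> (\<lambda>k. f v (x - k)) ` {1..K} \<union> T"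
      proof (cases "k \<in> {1..K}")
        case True
        from ik(2) consider "v = i" "u = f v k" | "u = i" "v = f u k"
          by (auto simp: doubleton_eq_iff)
        then show ?thesis
        proof cases
          case 2
          have "u = f v (x - k)"
            using I(1-3)[OF ik(1)] unfolding 2 f_def by simp
          then show ?thesis using True by blast
        qed (use True in blast)
      next
        case False
        then have "odd d" "k = h" "i < h" using ik(1) unfolding I_def by (auto split: if_splits)
        moreover have "f i h = i + h" using \<open>i < h\<close> h unfolding f_def by simp
        ultimately have "u \<in> T" using ik(2) unfolding T_def by (auto simp: doubleton_eq_iff)
        then show ?thesis by blast
      qed
    qed
    then have "card (nbh E v) \<le> card (f v ` {1..K} \<union> (\<lambda>k. f v (x - k)) ` {1..K} \<union> T)"
      by (rule card_mono[rotated]) (simp add: T_def)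
    also have "\<dots> \<le> card (f v ` {1..K}) + card ((\<lambda>k. f v (x - k)) ` {1..K}) + card T"
      by (rule order_trans[OF card_Un_le]) (simp add: card_Un_le)
    also have "\<dots> \<le> K + K + card T"
      by (intro add_mono order_refl) (use card_image_le[of "{1..K}"] in auto)
    also have "\<dots> \<le> d" unfolding T_def K_def by (auto simp: mult_2[symmetric])
    finally show ?thesis .
  qed
  ultimately show ?thesis using that by blast
qed

section \<open>Gluing \<open>G\<close>, \<open>H\<close> and prescribed neighbourhoods\<close>

lemma simple_graphI:
  assumes "\<And>e. e \<in> E \<Longrightarrow> card e = 2 \<and> e \<subseteq> {..<n}"
  shows "simple_graph n E"
  unfolding simple_graph_def
proof
  fix e assume "e \<in> E"
  then obtain u v where "e = {u, v}" "u \<noteq> v" "e \<subseteq> {..<n}"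
    using assms card_2_iff by metis
  then show "e \<in> {e. \<exists>u v. u \<noteq> v \<and> u < n \<and> v < n \<and> e = {u, v}}" by blast
qed

text \<open>If one side of a copy of the bipartite graph lies in \<open>{..<x}\<close>, the degree
  bound on \<open>G\<close> and \<open>mult\<close> exclude it; otherwise both sides have vertices
  outside, joined by an edge of \<open>H\<close>, which is the case left to \<open>mixed\<close>. A
  matching has at most \<open>x\<close> edges meeting \<open>{..<x}\<close>, and its other edges lie
  in \<open>H\<close>.\<close>

lemma join_graph:
  fixes x m n l t :: nat and N :: "nat \<Rightarrow> nat set"
  assumes l: "1 \<le> l" "l \<le> t" and xm: "x + m \<le> n"
    and G: "simple_graph x G" "\<And>v. card (nbh G v) < l"
    and H: "H \<subseteq> {e. e \<subseteq> {x..<x + m} \<and> card e = 2}"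
    and N: "\<And>v. v \<in> {x..<n} \<Longrightarrow> N v \<subseteq> {..<x} \<and> card (N v) \<le> l"
    and mult: "\<And>L. L \<subseteq> {..<x} \<Longrightarrow> card L = l \<Longrightarrow> card {v \<in> {x..<n}. L \<subseteq> N v} < t"
    and E: "E = G \<union> H \<union> (\<lambda>(v, u). {u, v}) ` (SIGMA v:{x..<n}. N v)"
    and mixed: "\<And>A B a b. A \<inter> B = {} \<Longrightarrow> card A = l \<Longrightarrow> card B = t \<Longrightarrow>
      (\<forall>a\<in>A. \<forall>b\<in>B. {a, b} \<in> E) \<Longrightarrow> a \<in> A \<inter> {x..<x + m} \<Longrightarrow> b \<in> B \<inter> {x..<x + m} \<Longrightarrow> False"
  shows "simple_graph n E" and "\<not> contains_Klt l t E"
    and "\<not> contains_matching (Suc (x + m div 2)) E"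
    and "card E = card G + card H + (\<Sum>v\<in>{x..<n}. card (N v))"
proof -
  define J where "J = (\<lambda>(v, u). {u, v}) ` (SIGMA v:{x..<n}. N v)"
  have Gsub: "e \<subseteq> {..<x}" "e \<noteq> {}" if "e \<in> G" for e
    using simple_graph_edgeD[OF G(1) that] by auto
  have Hsub: "e \<subseteq> {x..<x + m}" "card e = 2" if "e \<in> H" for e
    using H that by auto
  have Jsub: "\<exists>u v. e = {u, v} \<and> u < x \<and> x \<le> v \<and> v < n \<and> u \<in> N v" if "e \<in> J" for e
    using that N unfolding J_def by fastforce
  show sg: "simple_graph n E"
  proof (rule simple_graphI)
    fix e assume "e \<in> E"
    then consider "e \<in> G" | "e \<in> H" | "e \<in> J" unfolding E J_def by blast
    then show "card e = 2 \<and> e \<subseteq> {..<n}"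
    proof cases
      case 1
      then show ?thesis using simple_graph_edgeD(2,3)[OF G(1) 1] xm by fastforce
    next
      case 2
      then show ?thesis using Hsub[OF 2] xm by fastforce
    next
      case 3
      then show ?thesis using Jsub[OF 3] by auto
    qed
  qed
  have adj_in: "{u, v} \<in> G" if "{u, v} \<in> E" "u < x" "v < x" for u v
    using that Hsub(1)[of "{u, v}"] Jsub[of "{u, v}"]
    unfolding E J_def[symmetric] by (auto simp: doubleton_eq_iff)
  have adj_cross: "v < n" "u \<in> N v" if "{u, v} \<in> E" "u < x" "x \<le> v" for u v
    using that Hsub(1)[of "{u, v}"] Gsub(1)[of "{u, v}"] Jsub[of "{u, v}"]
    unfolding E J_def[symmetric] by (auto simp: doubleton_eq_iff)
  have adj_out: "{u, v} \<in> H" if "{u, v} \<in> E" "x \<le> u" "x \<le> v" for u v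
    using that Gsub(1)[of "{u, v}"] Jsub[of "{u, v}"]
    unfolding E J_def[symmetric] by (auto simp: doubleton_eq_iff)
  have deg_in: "card S < l" if "v < x" "S \<subseteq> {..<x}" "\<forall>u\<in>S. {u, v} \<in> E" for v S
  proof -
    have "S \<subseteq> nbh G v" using that adj_in unfolding nbh_def by (auto simp: insert_commute)
    then have "card S \<le> card (nbh G v)" using card_mono finite_nbh[OF G(1)] by blast
    then show ?thesis using G(2)[of v] by simp
  qed
  have no_common: False
    if L: "L \<subseteq> {..<x}" "card L = l" and C: "card C = t" "\<forall>a\<in>L. \<forall>c\<in>C. {a, c} \<in> E" for L C
  proof -
    have "L \<noteq> {}" using L(2) l by auto
    then obtain a0 where a0: "a0 \<in> L" by blast
    have "C \<subseteq> {v \<in> {x..<n}. L \<subseteq> N v}"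
    proof
      fix c assume c: "c \<in> C"
      \<comment> \<open>A vertex of \<open>C\<close> below \<open>x\<close> would have all
        \<open>l\<close> vertices of \<open>L\<close> as neighbours in \<open>G\<close>.\<close>
      have "x \<le> c" using deg_in[of c L] L C(2) c by force
      have "a < x \<and> {a, c} \<in> E" if "a \<in> L" for a using that L(1) C(2) c by auto
      then have "c < n \<and> a \<in> N c" if "a \<in> L" for a using that adj_cross \<open>x \<le> c\<close> by blast
      then show "c \<in> {v \<in> {x..<n}. L \<subseteq> N v}" using a0 \<open>x \<le> c\<close> by auto
    qed
    then have "card C \<le> card {v \<in> {x..<n}. L \<subseteq> N v}" by (rule card_mono[rotated]) simp
    then show False using mult[OF L] C(1) by simp
  qed
  show "\<not> contains_Klt l t E"
  proof
    assume "contains_Klt l t E"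
    then obtain A B where AB: "A \<inter> B = {}" "card A = l" "card B = t" "\<forall>a\<in>A. \<forall>b\<in>B. {a, b} \<in> E"
      unfolding contains_Klt_def by blast
    have "\<not> A \<subseteq> {..<x}" using no_common[of A B] AB by blast
    then obtain a where a: "a \<in> A" "x \<le> a" by force
    have "\<not> B \<subseteq> {..<x}"
    proof
      assume B: "B \<subseteq> {..<x}"
      have "B \<noteq> {}" using AB(3) l by auto
      then obtain b0 where b0: "b0 \<in> B" by blast
      have "b < x \<and> {b, a} \<in> E" if "b \<in> B" for b
        using that AB(4) a(1) B by (auto simp: insert_commute)
      then have "a < n \<and> b \<in> N a" if "b \<in> B" for b using that adj_cross a(2) by blast
      then have "B \<subseteq> N a" "a < n" using b0 by auto
      then have "N a \<subseteq> {..<x}" "card (N a) \<le> l" using N[of a] a(2) by auto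
      then have "card B \<le> l"
        using card_mono[OF finite_subset[of "N a" "{..<x}"] \<open>B \<subseteq> N a\<close>] by simp
      \<comment> \<open>Hence \<open>t = l\<close>, and the two sides can exchange roles.\<close>
      then have "t \<le> l" using AB(3) by simp
      then have "card B = l" "card A = t" using AB l by auto
      moreover have "\<forall>b\<in>B. \<forall>a\<in>A. {b, a} \<in> E" using AB(4) by (metis insert_commute)
      ultimately show False using no_common[OF B] by blast
    qed
    then obtain b where b: "b \<in> B" "x \<le> b" by force
    have "{a, b} \<in> H" using adj_out AB(4) a b by blast
    then show False using mixed[OF AB, of a b] Hsub(1) a b by blast
  qed
  show "\<not> contains_matching (Suc (x + m div 2)) E"
  proof
    assume "contains_matching (Suc (x + m div 2)) E"
    then obtain M where M: "M \<subseteq> E" "card M = Suc (x + m div 2)"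
      "\<forall>e\<in>M. \<forall>f\<in>M. e \<noteq> f \<longrightarrow> e \<inter> f = {}"
      unfolding contains_matching_def by blast
    have fM: "finite M" using M(1) finite_edges[OF sg] finite_subset by blast
    define P where "P = {e \<in> M. e \<inter> {..<x} \<noteq> {}}"
    define Q where "Q = {e \<in> M. e \<inter> {..<x} = {}}"
    \<comment> \<open>Choosing a vertex below \<open>x\<close> on each edge is injective because the
      edges are disjoint.\<close>
    define g where "g e = (SOME v. v \<in> e \<inter> {..<x})" for e
    have g: "g e \<in> e \<inter> {..<x}" if "e \<in> P" for e
      unfolding g_def by (rule someI_ex) (use that in \<open>auto simp: P_def\<close>)
    have "inj_on g P"
    proof (rule inj_onI)
      fix e e' assume ee: "e \<in> P" "e' \<in> P" "g e = g e'"
      have "g e \<in> e \<inter> e'" using g[OF ee(1)] g[OF ee(2)] ee(3) by simp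
      moreover have "e \<in> M" "e' \<in> M" using ee unfolding P_def by auto
      ultimately show "e = e'" using M(3) by (metis empty_iff)
    qed
    then have "card P \<le> card {..<x}" by (rule card_inj_on_le) (use g in auto)
    then have P: "card P \<le> x" by simp
    have QM: "Q \<subseteq> H"
      using M(1) Gsub Jsub unfolding Q_def E J_def[symmetric] by fastforce
    have "card (\<Union>Q) = (\<Sum>e\<in>Q. card e)"
    proof (rule card_Union_disjoint)
      show "pairwise disjnt Q" using M(3) unfolding Q_def pairwise_def disjnt_def by blast
      show "finite e" if "e \<in> Q" for e using that QM Hsub(1) finite_subset by blast
    qed
    also have "\<dots> = 2 * card Q" using QM Hsub(2) by (simp add: subset_iff)
    finally have "2 * card Q \<le> card {x..<x + m}"
      using card_mono[of "{x..<x + m}" "\<Union>Q"] QM Hsub(1) by fastforce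
    then have Q: "card Q \<le> m div 2" by simp
    have "M = P \<union> Q" unfolding P_def Q_def by blast
    then have "card M \<le> card P + card Q" using card_Un_le by blast
    then show False using P Q M(2) by simp
  qed
  show "card E = card G + card H + (\<Sum>v\<in>{x..<n}. card (N v))"
  proof -
    have fN: "finite (N v)" if "v \<in> {x..<n}" for v using N[OF that] finite_subset by blast
    have "inj_on (\<lambda>(v, u). {u, v}) (SIGMA v:{x..<n}. N v)"
      using N by (fastforce simp: inj_on_def doubleton_eq_iff)
    then have "card J = (\<Sum>v\<in>{x..<n}. card (N v))"
      unfolding J_def using fN by (simp add: card_image card_SigmaI)
    moreover have fin: "finite G" "finite H" "finite J"
      using finite_edges[OF sg] unfolding E J_def by auto
    moreover have "G \<inter> H = {}" using Gsub Hsub by fastforce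
    moreover have "(G \<union> H) \<inter> J = {}"
      using Gsub Hsub(1) Jsub by fastforce
    ultimately show ?thesis unfolding E J_def[symmetric] by (simp add: card_Un_disjoint)
  qed
qed

text \<open>Each \<open>l\<close>-subset of \<open>{..<x}\<close> is assigned to a block of \<open>t - 1\<close> consecutive vertices.\<close>
lemma neighbourhood_assignment:
  assumes "1 \<le> l" "l \<le> x" "2 \<le> t" and n: "y + (t - 1) * (x choose l) \<le> n"
  obtains N where "\<And>v. N v \<subseteq> {..<x}" "\<And>v. card (N v) \<le> l"
    "\<And>L. L \<subseteq> {..<x} \<Longrightarrow> card L = l \<Longrightarrow> card {v \<in> {y..<n}. L \<subseteq> N v} < t"
    "(\<Sum>v\<in>{y..<n}. card (N v)) = (l - 1) * (n - y) + (t - 1) * (x choose l)"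
proof -
  define q where "q = x choose l"
  define LL where "LL = {L. L \<subseteq> {..<x} \<and> card L = l}"
  have "card LL = q" "finite LL" unfolding LL_def q_def by (simp_all add: n_subsets)
  then obtain h where h: "bij_betw h {0..<q} LL" using ex_bij_betw_nat_finite by metis
  \<comment> \<open>The reduction \<open>mod q\<close> makes the index valid for every
    \<open>v\<close>, also below \<open>y\<close>. Vertices past the blocks get the default
    \<open>{..<l - 1}\<close>, too small to contain an \<open>l\<close>-set.\<close>
  define N where "N v = (if v < y + (t - 1) * q then h ((v - y) div (t - 1) mod q) else {..<l - 1})" for v
  have cN: "N v \<in> LL" if "v < y + (t - 1) * q" for v
  proof -
    have "0 < q" unfolding q_def using assms(2) by simp
    then show ?thesis using that h unfolding N_def bij_betw_def by auto
  qed
  have "card {v \<in> {y..<n}. L \<subseteq> N v} < t" if L: "L \<subseteq> {..<x}" "card L = l" for L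
  proof -
    have "L \<in> LL" using L unfolding LL_def by simp
    then have "L \<in> h ` {0..<q}" using h unfolding bij_betw_def by simp
    then obtain i where i: "i < q" "L = h i" by auto
    have "{v \<in> {y..<n}. L \<subseteq> N v} \<subseteq> {y + i * (t - 1)..<y + i * (t - 1) + (t - 1)}"
    proof
      fix v assume "v \<in> {v \<in> {y..<n}. L \<subseteq> N v}"
      then have v: "y \<le> v" "L \<subseteq> N v" by auto
      have lt: "v < y + (t - 1) * q"
      proof (rule ccontr)
        assume "\<not> v < y + (t - 1) * q"
        then have "L \<subseteq> {..<l - 1}" using v(2) unfolding N_def by simp
        then have "card L \<le> l - 1" using card_mono[of "{..<l - 1}" L] by simp
        then show False using L(2) assms(1) by simp
      qed
      have d: "(v - y) div (t - 1) < q"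
        using lt v(1) assms(3) by (simp add: less_mult_imp_div_less mult.commute)
      have "finite (N v)" "card (N v) = l"
        using cN[OF lt] unfolding LL_def by (auto intro: finite_subset)
      then have "L = N v" using card_subset_eq[of "N v" L] v(2) L(2) by simp
      then have "h i = h ((v - y) div (t - 1))" using i lt d unfolding N_def by simp
      then have "i = (v - y) div (t - 1)"
        using h i(1) d unfolding bij_betw_def inj_on_def by simp
      then have "v - y = i * (t - 1) + (v - y) mod (t - 1)"
        by (simp only: div_mult_mod_eq)
      moreover have "(v - y) mod (t - 1) < t - 1" using assms(3) by simp
      ultimately show "v \<in> {y + i * (t - 1)..<y + i * (t - 1) + (t - 1)}"
        using v(1) unfolding atLeastLessThan_iff by linarith
    qed
    then have "card {v \<in> {y..<n}. L \<subseteq> N v} \<le> t - 1"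
      using card_mono[of "{y + i * (t - 1)..<y + i * (t - 1) + (t - 1)}"] by fastforce
    then show ?thesis using assms(3) by simp
  qed
  moreover have "N v \<subseteq> {..<x}" for v
    using cN[of v] assms(2) unfolding LL_def by (cases "v < y + (t - 1) * q") (auto simp: N_def)
  moreover have "card (N v) \<le> l" for v
    using cN[of v] unfolding LL_def by (cases "v < y + (t - 1) * q") (auto simp: N_def)
  moreover have "(\<Sum>v\<in>{y..<n}. card (N v)) = (l - 1) * (n - y) + (t - 1) * q"
  proof -
    let ?z = "y + (t - 1) * q"
    have yz: "y \<le> ?z" "?z \<le> n" using n unfolding q_def by auto
    have "(\<Sum>v\<in>{y..<n}. card (N v)) = (\<Sum>v\<in>{y..<?z}. card (N v)) + (\<Sum>v\<in>{?z..<n}. card (N v))"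
      by (rule sum.atLeastLessThan_concat[symmetric]) (use yz in auto)
    also have "(\<Sum>v\<in>{y..<?z}. card (N v)) = (\<Sum>v\<in>{y..<?z}. l)"
      using cN by (intro sum.cong) (auto simp: LL_def)
    also have "(\<Sum>v\<in>{?z..<n}. card (N v)) = (\<Sum>v\<in>{?z..<n}. l - 1)"
      by (intro sum.cong) (auto simp: N_def)
    also have "(\<Sum>v\<in>{y..<?z}. l) + (\<Sum>v\<in>{?z..<n}. l - 1) = (t - 1) * q * l + (n - ?z) * (l - 1)"
      by simp
    \<comment> \<open>Every vertex contributes \<open>l - 1\<close>, and each vertex in a block one
      more.\<close>
    also have "\<dots> = (l - 1) * (n - y) + (t - 1) * q"
    proof -
      obtain r where r: "n = ?z + r" using yz(2) le_iff_add by blast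
      obtain k where k: "l = Suc k" using assms(1) by (cases l) auto
      have ny: "n - y = (t - 1) * q + r" and nz: "n - ?z = r" using r by auto
      have "w * Suc k + r * (Suc k - 1) = (Suc k - 1) * (w + r) + w" for w by (simp add: algebra_simps)
      then show ?thesis unfolding ny nz k .
    qed
    finally show ?thesis .
  qed
  ultimately show ?thesis using that unfolding q_def by blast
qed

section \<open>The two families of lower bounds\<close>

lemma ceil_half_bounds: "y \<le> 2 * ceil_half y" "2 * ceil_half y \<le> y + 1"
  unfolding ceil_half_def by linarith+

lemma not_contains_Klt_empty:
  assumes "0 < l" "0 < t"
  shows "\<not> contains_Klt l t {}"
proof
  assume "contains_Klt l t {}"
  then obtain A B :: "nat set" where AB: "card A = l" "card B = t" "\<forall>a\<in>A. \<forall>b\<in>B. {a, b} \<in> ({} :: nat set set)"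
    unfolding contains_Klt_def by blast
  then have "A \<noteq> {}" "B \<noteq> {}" using assms by auto
  then show False using AB(3) by blast
qed

text \<open>Here \<open>k\<close> is the number of vertices of \<open>X\<close> joined to all of \<open>H\<close>. The graph being constructed
  is not known to the caller, so \<open>mixed\<close> quantifies over all graphs with the same edges at the
  vertices of \<open>H\<close>.\<close>
lemma ex_Klt_M_join_ge:
  assumes l: "3 \<le> l" "l \<le> t" and x: "l \<le> x" "x \<le> s" and n: "nfun l t s x \<le> n"
    and m: "m = 2 * (s - x) + 1" and k: "k \<le> l - 1"
    and H: "H \<subseteq> {e. e \<subseteq> {x..<x + m} \<and> card e = 2}"
    and mixed: "\<And>E A B a b. A \<inter> B = {} \<Longrightarrow> card A = l \<Longrightarrow> card B = t \<Longrightarrow>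
      (\<forall>a\<in>A. \<forall>b\<in>B. {a, b} \<in> E) \<Longrightarrow> a \<in> A \<inter> {x..<x + m} \<Longrightarrow> b \<in> B \<inter> {x..<x + m} \<Longrightarrow>
      (\<And>u v. {u, v} \<in> E \<Longrightarrow> v \<in> {x..<x + m} \<Longrightarrow> u < k \<or> x \<le> u \<and> {u, v} \<in> H) \<Longrightarrow> False"
  shows "(int l - 1) * int n + (int t - 1) * int (x choose l) + int (card H)
    - ceil_half (int x * (int l - 1)) - int m * (int l - 1 - int k) \<le> int (ex_Klt_M n l t s)"
proof -
  have n': "x + m + (t - 1) * (x choose l) \<le> n" using n unfolding nfun_def m by simp
  obtain G where G: "simple_graph x G" "\<And>v. card (nbh G v) \<le> l - 1" "x * (l - 1) \<le> Suc (2 * card G)"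
    by (rule near_regular_graph[of "l - 1" x]) (use l x in auto)
  obtain N where N: "\<And>v. N v \<subseteq> {..<x}" "\<And>v. card (N v) \<le> l"
    "\<And>L. L \<subseteq> {..<x} \<Longrightarrow> card L = l \<Longrightarrow> card {v \<in> {x + m..<n}. L \<subseteq> N v} < t"
    "(\<Sum>v\<in>{x + m..<n}. card (N v)) = (l - 1) * (n - (x + m)) + (t - 1) * (x choose l)"
    by (rule neighbourhood_assignment[OF _ x(1) _ n']) (use l in auto)
  define N' where "N' v = (if v < x + m then {..<k} else N v)" for v
  define E where "E = G \<union> H \<union> (\<lambda>(v, u). {u, v}) ` (SIGMA v:{x..<n}. N' v)"
  have kx: "k < x" using k x l by simp
  have mixed': False
    if "A \<inter> B = {}" "card A = l" "card B = t" "\<forall>a\<in>A. \<forall>b\<in>B. {a, b} \<in> E"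
      "a \<in> A \<inter> {x..<x + m}" "b \<in> B \<inter> {x..<x + m}" for A B a b
  proof (rule mixed[OF that])
    fix u v assume uv: "{u, v} \<in> E" "v \<in> {x..<x + m}"
    have "{u, v} \<notin> G" using simple_graph_edgeD(3)[OF G(1), of "{u, v}"] uv(2) by auto
    then consider "{u, v} \<in> H"
      | v' u' where "v' \<in> {x..<n}" "u' \<in> N' v'" "{u, v} = {u', v'}"
      using uv(1) unfolding E_def by auto
    then show "u < k \<or> x \<le> u \<and> {u, v} \<in> H"
    proof cases
      case 1
      then show ?thesis using H by auto
    next
      case 2
      have "u' < x" using 2(2) N(1)[of v'] kx unfolding N'_def by (auto split: if_splits)
      then have "u = u'" "v = v'" using 2(3) uv(2) by (auto simp: doubleton_eq_iff)
      then show ?thesis using 2(2) uv(2) unfolding N'_def by simp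
    qed
  qed
  have mult: "card {v \<in> {x..<n}. L \<subseteq> N' v} < t" if L: "L \<subseteq> {..<x}" "card L = l" for L
  proof -
    \<comment> \<open>Since \<open>k < l\<close>, the vertices of \<open>H\<close> never count as
      common neighbours of an \<open>l\<close>-set.\<close>
    have "\<not> L \<subseteq> {..<k}"
      using card_mono[of "{..<k}" L] L(2) k l by auto
    then have "{v \<in> {x..<n}. L \<subseteq> N' v} = {v \<in> {x + m..<n}. L \<subseteq> N v}"
      unfolding N'_def by (auto simp: not_less split: if_splits)
    then show ?thesis using N(3)[OF L] by simp
  qed
  have facts: "1 \<le> l" "x + m \<le> n" "\<And>v. card (nbh G v) < l"
    "\<And>v. v \<in> {x..<n} \<Longrightarrow> N' v \<subseteq> {..<x} \<and> card (N' v) \<le> l"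
    using l n' G(2) N(1,2) kx k by (auto simp: N'_def less_eq_Suc_le[symmetric] le_diff_conv2 Suc_le_eq)
  have join: "simple_graph n E" "\<not> contains_Klt l t E" "\<not> contains_matching (Suc (x + m div 2)) E"
    "card E = card G + card H + (\<Sum>v\<in>{x..<n}. card (N' v))"
    by (rule join_graph[where x = x and m = m and N = N' and G = G and H = H and l = l and t = t];
        fact facts l(2) G(1) H mult E_def mixed')+
  \<comment> \<open>The odd size of \<open>H\<close> gives one extra vertex at no cost in matching
    number.\<close>
  have "m div 2 = s - x" unfolding m by simp
  then have "x + m div 2 = s" using x by simp
  then have "card E \<le> ex_Klt_M n l t s"
    unfolding ex_Klt_M_def using join(1-3) by (intro card_le_ex) auto
  moreover have "(\<Sum>v\<in>{x..<n}. card (N' v)) = m * k + ((l - 1) * (n - (x + m)) + (t - 1) * (x choose l))"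
  proof -
    have "(\<Sum>v\<in>{x..<n}. card (N' v)) = (\<Sum>v\<in>{x..<x + m}. card (N' v)) + (\<Sum>v\<in>{x + m..<n}. card (N' v))"
      by (rule sum.atLeastLessThan_concat[symmetric]) (use n' in auto)
    then show ?thesis using N(4) by (simp add: N'_def)
  qed
  ultimately have "card G + card H + (m * k + ((l - 1) * (n - (x + m)) + (t - 1) * (x choose l)))
      \<le> ex_Klt_M n l t s"
    using join(4) by simp
  moreover have "int (l - 1) = int l - 1" "int (t - 1) = int t - 1"
    "int (n - (x + m)) = int n - int x - int m"
    using l n' by (auto simp: of_nat_diff)
  ultimately have "int (card G) + int (card H) + (int m * int k +
      ((int l - 1) * (int n - int x - int m) + (int t - 1) * int (x choose l))) \<le> int (ex_Klt_M n l t s)"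
    by (metis (no_types, lifting) of_nat_add of_nat_le_iff of_nat_mult)
  \<comment> \<open>The term \<open>(l - 1) * n\<close> also charges \<open>l - 1\<close> for each
    vertex below \<open>x\<close>; \<open>G\<close> recovers all but the rounded-up half of
    this.\<close>
  moreover have "int x * (int l - 1) - int (card G) \<le> ceil_half (int x * (int l - 1))"
  proof -
    have "int (x * (l - 1)) \<le> int (Suc (2 * card G))" using G(3) by (simp only: of_nat_le_iff)
    then have "int x * (int l - 1) \<le> 1 + 2 * int (card G)" using l by (simp add: of_nat_diff)
    then show ?thesis using ceil_half_bounds(1)[of "int x * (int l - 1)"] by linarith
  qed
  ultimately show ?thesis by (simp add: algebra_simps)
qed

text \<open>Take \<open>k = l - 1\<close> and \<open>H\<close> complete. A copy with vertices of
  \<open>H\<close> on both sides is confined to \<open>l - 1 + m\<close> vertices, fewer than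
  \<open>l + t\<close> by \<open>small\<close>.\<close>

lemma F1_le_ex_Klt_M:
  assumes l: "3 \<le> l" "l \<le> t" and x: "l \<le> x" "x \<le> s" and n: "nfun l t s x \<le> n"
    and small: "2 * (s - x) + 1 \<le> t"
  shows "F1 l t s n (int x) \<le> int (ex_Klt_M n l t s)"
proof -
  define m where "m = 2 * (s - x) + 1"
  define H where "H = {e. e \<subseteq> {x..<x + m} \<and> card e = 2}"
  have "(int l - 1) * int n + (int t - 1) * int (x choose l) + int (card H)
    - ceil_half (int x * (int l - 1)) - int m * (int l - 1 - int (l - 1)) \<le> int (ex_Klt_M n l t s)"
  proof (rule ex_Klt_M_join_ge[OF l x n m_def order_refl])
    show "H \<subseteq> {e. e \<subseteq> {x..<x + m} \<and> card e = 2}" unfolding H_def by simp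
  next
    fix E A B a b
    assume AB: "A \<inter> B = {}" "card A = l" "card B = t" "\<forall>a\<in>A. \<forall>b\<in>B. {a, b} \<in> E"
      and a: "a \<in> A \<inter> {x..<x + m}" and b: "b \<in> B \<inter> {x..<x + m}"
      and adj: "\<And>u v. {u, v} \<in> E \<Longrightarrow> v \<in> {x..<x + m} \<Longrightarrow> u < l - 1 \<or> x \<le> u \<and> {u, v} \<in> H"
    have near: "u \<in> {..<l - 1} \<union> {x..<x + m}" if "{u, v} \<in> E" "v \<in> {x..<x + m}" for u v
      using adj[OF that] unfolding H_def by auto
    have "A \<union> B \<subseteq> {..<l - 1} \<union> {x..<x + m}"
    proof
      fix c assume "c \<in> A \<union> B"
      then have "{c, b} \<in> E \<or> {c, a} \<in> E" using AB(4) a b by (auto simp: insert_commute)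
      then show "c \<in> {..<l - 1} \<union> {x..<x + m}" using near a b by blast
    qed
    then have "card (A \<union> B) \<le> card ({..<l - 1} \<union> {x..<x + m})" by (rule card_mono[rotated]) simp
    also have "\<dots> \<le> l - 1 + m" using card_Un_le[of "{..<l - 1}" "{x..<x + m}"] by simp
    finally have "card (A \<union> B) < l + t" using small l unfolding m_def by simp
    moreover have "finite A" "finite B" using AB(2,3) l by (auto intro: card_ge_0_finite)
    then have "card (A \<union> B) = l + t" using AB(1-3) by (simp add: card_Un_disjoint)
    ultimately show False by simp
  qed
  moreover have "card H = m choose 2" unfolding H_def by (simp add: n_subsets)
  moreover have "nat (2 * (int s - int x) + 1) = m" unfolding m_def using x by simp
  ultimately show ?thesis using l unfolding F1_def by (simp add: of_nat_diff)
qed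

text \<open>Take \<open>k = 0\<close> and for \<open>H\<close> an extremal graph shifted by
  \<open>x\<close>. A copy with vertices of \<open>H\<close> on both sides lies entirely in
  \<open>H\<close>, and shifting it back contradicts the choice of \<open>F\<close>.\<close>

lemma F2_le_ex_Klt_M:
  assumes l: "3 \<le> l" "l \<le> t" and x: "l \<le> x" "x \<le> s" and n: "nfun l t s x \<le> n"
  shows "F2 l t s n (int x) \<le> int (ex_Klt_M n l t s)"
proof -
  define m where "m = 2 * (s - x) + 1"
  have "\<not> contains_Klt l t {}" using l by (intro not_contains_Klt_empty) auto
  moreover have "simple_graph m {}" by (simp add: simple_graph_def)
  ultimately obtain F where F: "simple_graph m F" "\<not> contains_Klt l t F" "card F = ex_Klt m l t"
    unfolding ex_Klt_def using ex_attained[of m "{}" "\<lambda>E. \<not> contains_Klt l t E"] by metis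
  define H where "H = (`) ((+) x) ` F"
  have HF: "{a - x, b - x} \<in> F" if ab: "{a, b} \<in> H" for a b
  proof -
    obtain e where e: "e \<in> F" "{a, b} = (+) x ` e" using ab unfolding H_def by blast
    have "e = (\<lambda>v. v - x) ` {a, b}" unfolding e(2) image_image by simp
    then show ?thesis using e(1) by simp
  qed
  have "(int l - 1) * int n + (int t - 1) * int (x choose l) + int (card H)
    - ceil_half (int x * (int l - 1)) - int m * (int l - 1 - int 0) \<le> int (ex_Klt_M n l t s)"
  proof (rule ex_Klt_M_join_ge[OF l x n m_def])
    show "0 \<le> l - 1" by simp
    show "H \<subseteq> {e. e \<subseteq> {x..<x + m} \<and> card e = 2}"
    proof
      fix e assume "e \<in> H"
      then obtain f where f: "f \<in> F" "e = (+) x ` f" unfolding H_def by blast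
      have "card e = card f" unfolding f(2) by (rule card_image) simp
      then show "e \<in> {e. e \<subseteq> {x..<x + m} \<and> card e = 2}"
        using f(2) simple_graph_edgeD(2,3)[OF F(1) f(1)] by auto
    qed
  next
    fix E A B a b
    assume AB: "A \<inter> B = {}" "card A = l" "card B = t" "\<forall>a\<in>A. \<forall>b\<in>B. {a, b} \<in> E"
      and a: "a \<in> A \<inter> {x..<x + m}" and b: "b \<in> B \<inter> {x..<x + m}"
      and adj: "\<And>u v. {u, v} \<in> E \<Longrightarrow> v \<in> {x..<x + m} \<Longrightarrow> u < 0 \<or> x \<le> u \<and> {u, v} \<in> H"
    have xA: "x \<le> c" if "c \<in> A" for c using adj[of c b] AB(4) b that by auto
    have xB: "x \<le> c" if "c \<in> B" for c using adj[of c a] AB(4) a that by (auto simp: insert_commute)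
    have inH: "{c, d} \<in> H" if "c \<in> A" "d \<in> B" for c d
    proof -
      \<comment> \<open>\<open>adj\<close> needs its second vertex inside the range of
        \<open>H\<close>; the edge from \<open>d\<close> to \<open>a\<close> supplies the upper
        bound.\<close>
      have "d < x + m"
      proof -
        have "{d, a} \<in> H" using adj[of d a] AB(4) a that(2) by (auto simp: insert_commute)
        then obtain f where f: "f \<in> F" "{d, a} = (+) x ` f" unfolding H_def by blast
        then have "d \<in> (+) x ` f" by blast
        then show ?thesis using simple_graph_edgeD(3)[OF F(1) f(1)] by auto
      qed
      then show ?thesis using adj[of c d] AB(4) that xB by auto
    qed
    let ?f = "\<lambda>v. v - x"
    have inj: "inj_on ?f (A \<union> B)" 
    proof (rule inj_onI)
      fix c d assume "c \<in> A \<union> B" "d \<in> A \<union> B" "c - x = d - x"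
      moreover from this have "x \<le> c" "x \<le> d" using xA xB by blast+
      ultimately show "c = d" by linarith
    qed
    have "?f ` A \<inter> ?f ` B = {}"
      using inj_on_image_Int[OF inj, of A B] AB(1) by auto
    moreover have "card (?f ` A) = l" "card (?f ` B) = t"
      using AB(2,3) inj by (auto simp: card_image inj_on_Un)
    moreover have "\<forall>a\<in>?f ` A. \<forall>b\<in>?f ` B. {a, b} \<in> F" using HF inH by auto
    ultimately show False using F(2) unfolding contains_Klt_def by blast
  qed
  moreover have "card H = ex_Klt m l t"
    unfolding H_def F(3)[symmetric] by (intro card_image inj_on_image) simp
  moreover have "nat (2 * (int s - int x) + 1) = m" "int m = 2 * (int s - int x) + 1"
    unfolding m_def using x by auto
  ultimately show ?thesis unfolding F2_def by (simp add: algebra_simps)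
qed

theorem theorem1p1:
  fixes l t :: nat
  assumes "3 \<le> l" and "l \<le> t"
  shows "(\<forall>s n. l + 1 \<le> s \<longrightarrow> 2 * s + 1 \<le> n \<longrightarrow> n1 l t s \<le> n \<longrightarrow>
            int (ex_Klt_M n l t s) \<ge> r1 l t s n \<and>
            (R2dom l t s \<noteq> {} \<longrightarrow> int (ex_Klt_M n l t s) \<ge> r2 l t s n))
       \<and> (\<exists>S0. \<forall>s n. S0 \<le> s \<longrightarrow> l + 1 \<le> s \<longrightarrow> 2 * s + 1 \<le> n \<longrightarrow>
            2 * (3 * s choose 2) \<le> n \<longrightarrow>
            int (ex_Klt_M n l t s) \<le> (int l - 1) * int n + (int t - 1) * int (s choose l)
               - ceil_half (int s * (int l - 1)))"
proof (intro conjI allI impI exI[of _ "10 * l"])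
  fix s n assume s: "l + 1 \<le> s" and n: "n1 l t s \<le> n"
  have nfun: "nfun l t s x \<le> n" if "x \<le> s" for x
  proof -
    have "nfun l t s x \<le> n1 l t s" unfolding n1_def using that by (intro Max_ge) auto
    then show ?thesis using n by simp
  qed
  define D where "D = {x. max (2 * int s - int t + 1) (2 * int l) \<le> 2 * x \<and> 2 * x \<le> 2 * int s}"
  have "finite D" by (rule finite_subset[of _ "{0..int s}"]) (auto simp: D_def)
  \<comment> \<open>The maximum is over a nonempty set, so it can be bounded elementwise.\<close>
  moreover have "int s \<in> D" unfolding D_def using s assms by simp
  moreover have "F1 l t s n x \<le> int (ex_Klt_M n l t s)" if "x \<in> D" for x
  proof -
    have "x = int (nat x)" "l \<le> nat x" "nat x \<le> s" "2 * (s - nat x) + 1 \<le> t"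
      using that unfolding D_def by auto
    then show ?thesis using F1_le_ex_Klt_M[OF assms] nfun by metis
  qed
  ultimately show "r1 l t s n \<le> int (ex_Klt_M n l t s)"
    unfolding r1_def D_def[symmetric] by (subst Max_le_iff) auto
  assume ne: "R2dom l t s \<noteq> {}"
  have "finite (R2dom l t s)" by (rule finite_subset[of _ "{0..int s}"]) (auto simp: R2dom_def)
  moreover have "F2 l t s n x \<le> int (ex_Klt_M n l t s)" if "x \<in> R2dom l t s" for x
  proof -
    have "x = int (nat x)" "l \<le> nat x" "nat x \<le> s" using that unfolding R2dom_def by auto
    then show ?thesis using F2_le_ex_Klt_M[OF assms] nfun by metis
  qed
  ultimately show "r2 l t s n \<le> int (ex_Klt_M n l t s)"
    unfolding r2_def using ne by (subst Max_le_iff) auto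
next
  fix s n assume s: "10 * l \<le> s"
  let ?P = "\<lambda>E. \<not> contains_Klt l t E \<and> \<not> contains_matching (Suc s) E"
  have "\<not> contains_Klt l t {}"
    using assms by (intro not_contains_Klt_empty) auto
  then have "?P {}" by (auto simp: contains_matching_def)
  moreover have "simple_graph n {}" by (simp add: simple_graph_def)
  ultimately obtain E where E: "simple_graph n E" "?P E" "card E = ex_Klt_M n l t s"
    unfolding ex_Klt_M_def using ex_attained[of n "{}" ?P] by blast
  have "2 * card E + s * (l - 1) \<le> 2 * (l - 1) * n + 2 * (t - 1) * (s choose l)"
    using Klt_matching_free_card_le[OF assms s E(1)] E(2) by blast
  then have "int (2 * card E + s * (l - 1)) \<le> int (2 * (l - 1) * n + 2 * (t - 1) * (s choose l))"
    by (simp only: of_nat_le_iff)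
  moreover have "int (l - 1) = int l - 1" "int (t - 1) = int t - 1"
    using assms by (auto simp: of_nat_diff)
  ultimately have "2 * int (card E) + int s * (int l - 1)
      \<le> 2 * ((int l - 1) * int n) + 2 * ((int t - 1) * int (s choose l))"
    by (simp add: mult.assoc)
  then show "int (ex_Klt_M n l t s) \<le> (int l - 1) * int n + (int t - 1) * int (s choose l)
      - ceil_half (int s * (int l - 1))"
    \<comment> \<open>The excess 1 from rounding disappears because both sides of the doubled
      inequality are even.\<close>
    using ceil_half_bounds(2)[of "int s * (int l - 1)"] E(3) by linarith
qed

end
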